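(* Let $C>0$. Every $C$-rCAT($0;*$) space is $C'$-rCAT(0) for $C'=3C+2+\sqrt3$. Every weak (respectively very weak) $C$-rCAT($0;*$) space is weak (respectively very weak) $C''$-rCAT(0) for $C''=2C+1+\sqrt3/2$.
   Context: A length space is a metric space $(X,d)$ in which $d(x,y)$ is the infimum of the lengths of paths joining $x$ and $y$, for all $x,y$. For $h\ge 0$, an $h$-short segment $[x,y]_h$ from $x$ to $y$ is a path $\gamma:[0,L]\to X$ from $x$ to $y$ with $\mathrm{len}(\gamma)\le d(x,y)+h$. For a point $u=\gamma(t)$ on it, $[x,u]_h$ and $[u,y]_h$ denote the subpaths $\gamma|_{[0,t]}$ and $\gamma|_{[t,L]}$. An $h$-short triangle $T_h(x,y,z)$ consists of $x,y,z\in X$ with a choice of $h$-short segments (sides) $[x,y]_h,[y,z]_h,[z,x]_h$. A comparison triangle is a Euclidean triangle $T(\bar x,\bar y,\bar z)$ in the plane with $|\bar x-\bar y|=d(x,y)$, $|\bar y-\bar z|=d(y,z)$, $|\bar z-\bar x|=d(z,x)$. A comparison point for $u\in[x,y]_h$ is any $\bar u\in[\bar x,\bar y]$ with $|\bar x-\bar u|\le\mathrm{len}([x,u]_h)$ and $|\bar u-\bar y|\le\mathrm{len}([u,y]_h)$ (not necessarily unique); similarly for the other sides. $T_h(x,y,z)$ satisfies the $C$-rough CAT(0) condition if $d(u,v)\le|\bar u-\bar v|+C$ whenever $u,v$ lie on different sides of $T_h(x,y,z)$ and $\bar u,\bar v$ are corresponding comparison points. It satisfies the weak $C$-rough CAT(0)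 condition if this is required only for $v=x$ (with $\bar v=\bar x$) and $u\in[y,z]_h$. It satisfies the very weak $C$-rough CAT(0) condition if this is required only for $v=x$ (with $\bar v=\bar x$) and $u\in[y,z]_h$ an $h$-midpoint, i.e. a point for which the Euclidean midpoint $\bar u$ of $[\bar y,\bar z]$ is a comparison point (and with this $\bar u$ in the inequality). A length space $X$ is $C$-rCAT($0;*$) if there is a function $H:X\times X\times X\to(0,\infty)$ such that for all $x,y,z\in X$ every $h$-short triangle $T_h(x,y,z)$ with $h=H(x,y,z)$ satisfies the $C$-rough CAT(0) condition; it is $C$-rCAT(0) if this holds with the standard choice $H(x,y,z)=1/\max\{1,d(x,y),d(x,z),d(y,z)\}$. The weak and very weak versions of these two notions are defined in the same way using the weak, respectively very weak, $C$-rough CAT(0) condition. *)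

theory Defs
  imports "HOL-Analysis.Analysis"
begin

text \<open>
  A metric space is given as a set \<open>X\<close> in a type of class \<^class>\<open>metric_space\<close>, with the
  restricted metric; paths have to stay in \<open>X\<close>.
\<close>

text \<open>Metric length of \<open>\<gamma>\<close> on \<open>{a..b}\<close>, for \<open>a \<le> b\<close>: supremum over all partitions.\<close>

definition path_len :: "(real \<Rightarrow> 'a::metric_space) \<Rightarrow> real \<Rightarrow> real \<Rightarrow> ereal" where
  "path_len \<gamma> a b =
     (SUP (n, t) \<in> {(n :: nat, t :: nat \<Rightarrow> real). t 0 = a \<and> t n = b \<and> (\<forall>i<n. t i \<le> t (Suc i))}.
        ereal (\<Sum>i<n. dist (\<gamma> (t i)) (\<gamma> (t (Suc i)))))"

text \<open>A pair \<open>(L, \<gamma>)\<close> stands for the path \<open>\<gamma>\<close> restricted to \<open>{0..L}\<close>.\<close>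

type_synonym 'a mpath = "real \<times> (real \<Rightarrow> 'a)"

definition len :: "'a::metric_space mpath \<Rightarrow> ereal" where
  "len \<sigma> = path_len (snd \<sigma>) 0 (fst \<sigma>)"

definition paths_in :: "'a::metric_space set \<Rightarrow> 'a \<Rightarrow> 'a \<Rightarrow> 'a mpath set" where
  "paths_in X x y = {(L, \<gamma>). 0 \<le> L \<and> continuous_on {0..L} \<gamma> \<and> \<gamma> ` {0..L} \<subseteq> X \<and> \<gamma> 0 = x \<and> \<gamma> L = y}"

definition length_space :: "'a::metric_space set \<Rightarrow> bool" where
  "length_space X \<longleftrightarrow> (\<forall>x\<in>X. \<forall>y\<in>X. ereal (dist x y) = (INF \<sigma> \<in> paths_in X x y. len \<sigma>))"

definition short_segments :: "'a::metric_space set \<Rightarrow> real \<Rightarrow> 'a \<Rightarrow> 'a \<Rightarrow> 'a mpath set" where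
  "short_segments X h x y = {\<sigma> \<in> paths_in X x y. len \<sigma> \<le> ereal (dist x y + h)}"

definition comparison_triangle ::
  "'a::metric_space \<Rightarrow> 'a \<Rightarrow> 'a \<Rightarrow> real^2 \<Rightarrow> real^2 \<Rightarrow> real^2 \<Rightarrow> bool" where
  "comparison_triangle x y z x' y' z' \<longleftrightarrow>
     dist x' y' = dist x y \<and> dist y' z' = dist y z \<and> dist z' x' = dist z x"

text \<open>
  \<open>u'\<close> is a comparison point on the Euclidean segment from \<open>p'\<close> to \<open>q'\<close> for the point with
  parameter \<open>t\<close> on the path \<open>\<sigma>\<close>. A point of a path is always taken together with a parameter,
  since the two subpaths depend on it when the path is not injective.
\<close>

definition comparison_point ::
  "'a::metric_space mpath \<Rightarrow> real \<Rightarrow> real^2 \<Rightarrow> real^2 \<Rightarrow> real^2 \<Rightarrow> bool" where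
  "comparison_point \<sigma> t p' q' u' \<longleftrightarrow>
     u' \<in> closed_segment p' q' \<and>
     ereal (dist p' u') \<le> path_len (snd \<sigma>) 0 t \<and>
     ereal (dist u' q') \<le> path_len (snd \<sigma>) t (fst \<sigma>)"

definition sides_rough_CAT0 ::
  "real \<Rightarrow> 'a::metric_space mpath \<Rightarrow> real^2 \<Rightarrow> real^2 \<Rightarrow> 'a mpath \<Rightarrow> real^2 \<Rightarrow> real^2 \<Rightarrow> bool" where
  "sides_rough_CAT0 C \<sigma> p' q' \<tau> r' s' \<longleftrightarrow>
     (\<forall>t\<in>{0..fst \<sigma>}. \<forall>t'\<in>{0..fst \<tau>}. \<forall>u' v'.
        comparison_point \<sigma> t p' q' u' \<longrightarrow> comparison_point \<tau> t' r' s' v' \<longrightarrow>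
        dist (snd \<sigma> t) (snd \<tau> t') \<le> dist u' v' + C)"

text \<open>
  The three conditions on a triangle with vertices \<open>x, y, z\<close> and sides \<open>\<alpha>\<close> from \<open>x\<close> to \<open>y\<close>,
  \<open>\<beta>\<close> from \<open>y\<close> to \<open>z\<close>, and \<open>\<gamma>\<close> from \<open>z\<close> to \<open>x\<close>. In the first one the three unordered pairs
  of sides suffice because the inequality is symmetric.
\<close>

type_synonym 'a triangle_condition =
  "'a \<Rightarrow> 'a \<Rightarrow> 'a \<Rightarrow> 'a mpath \<Rightarrow> 'a mpath \<Rightarrow> 'a mpath \<Rightarrow> bool"

definition rough_CAT0 :: "real \<Rightarrow> 'a::metric_space triangle_condition" where
  "rough_CAT0 C x y z \<alpha> \<beta> \<gamma> \<longleftrightarrow>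
     (\<forall>x' y' z'. comparison_triangle x y z x' y' z' \<longrightarrow>
        sides_rough_CAT0 C \<alpha> x' y' \<beta> y' z' \<and>
        sides_rough_CAT0 C \<beta> y' z' \<gamma> z' x' \<and>
        sides_rough_CAT0 C \<gamma> z' x' \<alpha> x' y')"

definition weak_rough_CAT0 :: "real \<Rightarrow> 'a::metric_space triangle_condition" where
  "weak_rough_CAT0 C x y z \<alpha> \<beta> \<gamma> \<longleftrightarrow>
     (\<forall>x' y' z'. comparison_triangle x y z x' y' z' \<longrightarrow>
        (\<forall>t\<in>{0..fst \<beta>}. \<forall>u'. comparison_point \<beta> t y' z' u' \<longrightarrow>
           dist (snd \<beta> t) x \<le> dist u' x' + C))"

definition very_weak_rough_CAT0 :: "real \<Rightarrow> 'a::metric_space triangle_condition" where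
  "very_weak_rough_CAT0 C x y z \<alpha> \<beta> \<gamma> \<longleftrightarrow>
     (\<forall>x' y' z'. comparison_triangle x y z x' y' z' \<longrightarrow>
        (\<forall>t\<in>{0..fst \<beta>}. comparison_point \<beta> t y' z' (midpoint y' z') \<longrightarrow>
           dist (snd \<beta> t) x \<le> dist (midpoint y' z') x' + C))"

definition triangles_satisfy ::
  "'a::metric_space triangle_condition \<Rightarrow> 'a set \<Rightarrow> ('a \<Rightarrow> 'a \<Rightarrow> 'a \<Rightarrow> real) \<Rightarrow> bool" where
  "triangles_satisfy P X H \<longleftrightarrow>
     (\<forall>x\<in>X. \<forall>y\<in>X. \<forall>z\<in>X.
        \<forall>\<alpha>\<in>short_segments X (H x y z) x y.
        \<forall>\<beta>\<in>short_segments X (H x y z) y z.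
        \<forall>\<gamma>\<in>short_segments X (H x y z) z x. P x y z \<alpha> \<beta> \<gamma>)"

definition standard_H :: "'a::metric_space \<Rightarrow> 'a \<Rightarrow> 'a \<Rightarrow> real" where
  "standard_H x y z = 1 / Max {1, dist x y, dist x z, dist y z}"

definition rCAT0_star_for :: "'a::metric_space triangle_condition \<Rightarrow> 'a set \<Rightarrow> bool" where
  "rCAT0_star_for P X \<longleftrightarrow>
     length_space X \<and>
     (\<exists>H. (\<forall>x\<in>X. \<forall>y\<in>X. \<forall>z\<in>X. 0 < H x y z) \<and> triangles_satisfy P X H)"

definition rCAT0_for :: "'a::metric_space triangle_condition \<Rightarrow> 'a set \<Rightarrow> bool" where
  "rCAT0_for P X \<longleftrightarrow> length_space X \<and> triangles_satisfy P X standard_H"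

definition rCAT0_star :: "real \<Rightarrow> 'a::metric_space set \<Rightarrow> bool" where
  "rCAT0_star C = rCAT0_star_for (rough_CAT0 C)"

definition rCAT0 :: "real \<Rightarrow> 'a::metric_space set \<Rightarrow> bool" where
  "rCAT0 C = rCAT0_for (rough_CAT0 C)"

definition weak_rCAT0_star :: "real \<Rightarrow> 'a::metric_space set \<Rightarrow> bool" where
  "weak_rCAT0_star C = rCAT0_star_for (weak_rough_CAT0 C)"

definition weak_rCAT0 :: "real \<Rightarrow> 'a::metric_space set \<Rightarrow> bool" where
  "weak_rCAT0 C = rCAT0_for (weak_rough_CAT0 C)"

definition very_weak_rCAT0_star :: "real \<Rightarrow> 'a::metric_space set \<Rightarrow> bool" where
  "very_weak_rCAT0_star C = rCAT0_star_for (very_weak_rough_CAT0 C)"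

definition very_weak_rCAT0 :: "real \<Rightarrow> 'a::metric_space set \<Rightarrow> bool" where
  "very_weak_rCAT0 C = rCAT0_for (very_weak_rough_CAT0 C)"

end

(* Let u be a point of an h-short segment from y to z, and choose a point w with the same
   comparison point on a much shorter segment from y to z, short enough for the hypothesis to
   apply both to the given triangle and to the triangle u, y, z. The latter bounds d(u, w) by
   C plus the distance of the comparison points of u and w in the triangle u, y, z. By Stewart's
   theorem the square of that distance is at most h d(y, z) / 2 + h^2, which is at most 3/2 for
   the standard choice of h. Each replacement of u by w thus costs at most C + sqrt (3/2). *)

theory Submission
  imports Defs
begin

section \<open>Lengths of paths\<close>

lemma partition_le_path_len:
  assumes "t 0 = a" "t n = b" "\<And>i. i < n \<Longrightarrow> t i \<le> t (Suc i)"
  shows "ereal (\<Sum>i<n. dist (\<gamma> (t i)) (\<gamma> (t (Suc i)))) \<le> path_len \<gamma> a b"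
  unfolding path_len_def
  by (rule SUP_upper2[where i = "(n, t)"]) (use assms in auto)

lemma path_len_le:
  assumes "\<And>n t. t 0 = a \<Longrightarrow> t n = b \<Longrightarrow> (\<And>i. i < n \<Longrightarrow> t i \<le> t (Suc i)) \<Longrightarrow>
    ereal (\<Sum>i<n. dist (\<gamma> (t i)) (\<gamma> (t (Suc i)))) \<le> B"
  shows "path_len \<gamma> a b \<le> B"
  unfolding path_len_def by (rule SUP_least) (use assms in auto)

lemma dist_le_path_len:
  assumes "a \<le> b"
  shows "ereal (dist (\<gamma> a) (\<gamma> b)) \<le> path_len \<gamma> a b"
  using partition_le_path_len[of "\<lambda>i. if i = 0 then a else b" a 1 b \<gamma>] assms by simp

lemma path_len_nonneg:
  assumes "a \<le> b"
  shows "0 \<le> path_len \<gamma> a b"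
  by (rule order_trans[OF _ dist_le_path_len[OF assms]]) simp

text \<open>Joining a partition of \<open>{a..b}\<close> to one of \<open>{b..c}\<close> gives a
  partition of \<open>{a..c}\<close>. This is superadditivity of length, in a form free of infinite
  values.\<close>

lemma partitions_le_path_len:
  assumes t: "t 0 = a" "t n = b" "\<And>i. i < n \<Longrightarrow> t i \<le> t (Suc i)"
    and s: "s 0 = b" "s m = c" "\<And>i. i < m \<Longrightarrow> s i \<le> s (Suc i)"
  shows "ereal ((\<Sum>i<n. dist (\<gamma> (t i)) (\<gamma> (t (Suc i)))) + (\<Sum>i<m. dist (\<gamma> (s i)) (\<gamma> (s (Suc i)))))
    \<le> path_len \<gamma> a c"
proof -
  define r where "r i = (if i < n then t i else s (i - n))" for i
  have split: "(\<Sum>i<n + m. g i) = (\<Sum>i<n. g i) + (\<Sum>i<m. g (n + i))" for g :: "nat \<Rightarrow> real"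
    by (induction m) (simp_all add: add.assoc)
  \<comment> \<open>Since \<open>t n = b = s 0\<close>, the formula also holds at the junction
    \<open>i = n\<close>, so the last step of \<open>t\<close> is a step of
    \<open>r\<close>.\<close>
  have r1: "r i = t i" if "i \<le> n" for i
    using that t(2) s(1) by (auto simp: r_def)
  have r2: "r (n + i) = s i" for i
    by (simp add: r_def)
  have "ereal (\<Sum>i<n + m. dist (\<gamma> (r i)) (\<gamma> (r (Suc i)))) \<le> path_len \<gamma> a c"
  proof (rule partition_le_path_len)
    show "r 0 = a" "r (n + m) = c"
      using r1[of 0] r2[of m] t s by auto
    show "r i \<le> r (Suc i)" if "i < n + m" for i
    proof (cases "i < n")
      case True
      then show ?thesis using r1[of i] r1[of "Suc i"] t(3)[of i] by simp
    next
      case False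
      then show ?thesis
        using that r2[of "i - n"] r2[of "Suc (i - n)"] s(3)[of "i - n"] by simp
    qed
  qed
  moreover have "(\<Sum>i<n. dist (\<gamma> (r i)) (\<gamma> (r (Suc i)))) = (\<Sum>i<n. dist (\<gamma> (t i)) (\<gamma> (t (Suc i))))"
    by (rule sum.cong) (auto simp: r1)
  moreover have "(\<Sum>i<m. dist (\<gamma> (r (n + i))) (\<gamma> (r (Suc (n + i))))) =
      (\<Sum>i<m. dist (\<gamma> (s i)) (\<gamma> (s (Suc i))))"
    using r2 by (metis add_Suc_right)
  ultimately show ?thesis
    by (simp add: split)
qed

text \<open>With a partition of the right half fixed, the supremum is taken over those of the left
  half; then the right one varies. The bound \<open>B\<close> makes both lengths finite, so later
  estimates run in the reals.\<close>

lemma path_len_split: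
  assumes "a \<le> b" "b \<le> c" and le: "path_len \<gamma> a c \<le> ereal B"
  obtains p q where "path_len \<gamma> a b = ereal p" "path_len \<gamma> b c = ereal q" "p + q \<le> B"
proof -
  have sums: "ereal (\<Sum>i<n. dist (\<gamma> (t i)) (\<gamma> (t (Suc i))))
      \<le> ereal (B - (\<Sum>i<m. dist (\<gamma> (s i)) (\<gamma> (s (Suc i)))))"
    if "t 0 = a" "t n = b" "\<And>i. i < n \<Longrightarrow> t i \<le> t (Suc i)"
      "s 0 = b" "s m = c" "\<And>i. i < m \<Longrightarrow> s i \<le> s (Suc i)" for n t m s
    using order_trans[OF partitions_le_path_len[of t a n b s m c \<gamma>, OF that] le] by simp
  have ab: "path_len \<gamma> a b \<le> ereal (B - (\<Sum>i<m. dist (\<gamma> (s i)) (\<gamma> (s (Suc i)))))"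
    if "s 0 = b" "s m = c" "\<And>i. i < m \<Longrightarrow> s i \<le> s (Suc i)" for m s
    by (rule path_len_le) (rule sums, use that in auto)
  \<comment> \<open>The one-step partition of the right half suffices to see that the left length is
    finite.\<close>
  have "path_len \<gamma> a b \<le> ereal (B - dist (\<gamma> b) (\<gamma> c))"
    using ab[of "\<lambda>i. if i = 0 then b else c" 1] assms by simp
  then obtain p where p: "path_len \<gamma> a b = ereal p"
    using path_len_nonneg[OF assms(1), of \<gamma>] by (cases "path_len \<gamma> a b") auto
  have bc: "path_len \<gamma> b c \<le> ereal (B - p)"
  proof (rule path_len_le)
    fix m s
    assume "s 0 = b" "s m = c" "\<And>i. i < m \<Longrightarrow> s i \<le> s (Suc i)"
    from ab[OF this] show "ereal (\<Sum>i<m. dist (\<gamma> (s i)) (\<gamma> (s (Suc i)))) \<le> ereal (B - p)"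
      by (simp add: p)
  qed
  then obtain q where "path_len \<gamma> b c = ereal q"
    using path_len_nonneg[OF assms(2), of \<gamma>] by (cases "path_len \<gamma> b c") auto
  with bc p show thesis by (intro that) auto
qed

section \<open>Short segments: monotonicity, existence and basic facts\<close>

lemma short_segments_mono: "h \<le> k \<Longrightarrow> short_segments X h x y \<subseteq> short_segments X k x y"
  unfolding short_segments_def by (auto elim!: order_trans)

lemma short_segments_nonempty:
  assumes "length_space X" "x \<in> X" "y \<in> X" "0 < h"
  obtains \<sigma> where "\<sigma> \<in> short_segments X h x y"
proof -
  have "(INF \<sigma> \<in> paths_in X x y. len \<sigma>) < ereal (dist x y + h)"
    using assms unfolding length_space_def by (metis less_add_same_cancel1 less_ereal.simps(1))
  then obtain \<sigma> where "\<sigma> \<in> paths_in X x y" "len \<sigma> < ereal (dist x y + h)"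
    by (auto simp: INF_less_iff)
  then show thesis by (intro that[of \<sigma>]) (auto simp: short_segments_def)
qed

lemma short_segmentsD:
  assumes "\<sigma> \<in> short_segments X h x y"
  shows "0 \<le> fst \<sigma>" "continuous_on {0..fst \<sigma>} (snd \<sigma>)" "snd \<sigma> 0 = x" "snd \<sigma> (fst \<sigma>) = y"
    "t \<in> {0..fst \<sigma>} \<Longrightarrow> snd \<sigma> t \<in> X" "path_len (snd \<sigma>) 0 (fst \<sigma>) \<le> ereal (dist x y + h)"
  using assms by (auto simp: short_segments_def paths_in_def len_def)

section \<open>Comparison triangles and comparison points\<close>

lemma dist_vec2: "dist (vector [a, b] :: real^2) (vector [c, d]) = sqrt ((a - c)\<^sup>2 + (b - d)\<^sup>2)"
  by (simp add: dist_vec_def L2_set_def UNIV_2 dist_real_def)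

text \<open>For \<open>y \<noteq> z\<close>, the side from \<open>y'\<close> to \<open>z'\<close> is
  put on the first axis and \<open>x'\<close> is found by the law of cosines; the triangle
  inequalities make its height real. The case \<open>y = z\<close> is separate because the formula
  divides by that side.\<close>

lemma comparison_triangle_exists:
  obtains x' y' z' where "comparison_triangle x y z x' y' z'"
proof (cases "y = z")
  case True
  have "comparison_triangle x y z (vector [dist x y, 0]) (vector [0, 0]) (vector [0, 0])"
    unfolding comparison_triangle_def dist_vec2 using True by (simp add: dist_commute)
  then show thesis by (rule that)
next
  case False
  define l a b where "l = dist y z" and "a = dist x y" and "b = dist z x"
  \<comment> \<open>The abscissa of the foot of the altitude from \<open>x'\<close>, measured from
    \<open>y'\<close>.\<close>
  define s where "s = (a\<^sup>2 + l\<^sup>2 - b\<^sup>2) / (2 * l)"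
  have l: "l > 0" and nn: "a \<ge> 0" "b \<ge> 0"
    using False by (auto simp: l_def a_def b_def)
  have tri: "b \<le> a + l" "l \<le> a + b" "a \<le> b + l"
    using dist_triangle[of z x y] dist_triangle[of y z x] dist_triangle[of x y z]
    by (auto simp: l_def a_def b_def dist_commute)
  \<comment> \<open>Equivalent to \<open>\<bar>l - a\<bar> \<le> b \<le> a + l\<close>; it yields
    \<open>\<bar>s\<bar> \<le> a\<close>, so the square root in the height is harmless.\<close>
  have "\<bar>a\<^sup>2 + l\<^sup>2 - b\<^sup>2\<bar> \<le> 2 * l * a"
  proof -
    have "b\<^sup>2 \<le> (a + l)\<^sup>2" "(l - a)\<^sup>2 \<le> b\<^sup>2"
      using tri nn by (auto simp: power2_le_iff_abs_le)
    then show ?thesis by (simp add: power2_eq_square algebra_simps)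
  qed
  then have "\<bar>s\<bar> \<le> a"
    using l by (simp add: s_def abs_mult field_simps)
  then have sa: "s\<^sup>2 \<le> a\<^sup>2"
    using nn by (simp add: power2_le_iff_abs_le)
  have sl: "2 * s * l = a\<^sup>2 + l\<^sup>2 - b\<^sup>2"
    using l by (simp add: s_def)
  have "(l - s)\<^sup>2 + (a\<^sup>2 - s\<^sup>2) = b\<^sup>2"
    using sl by (simp add: power2_eq_square algebra_simps)
  then have "comparison_triangle x y z (vector [s, sqrt (a\<^sup>2 - s\<^sup>2)]) (vector [0, 0]) (vector [l, 0])"
    unfolding comparison_triangle_def dist_vec2 using sa l nn
    by (simp add: l_def[symmetric] a_def[symmetric] b_def[symmetric])
  then show thesis by (rule that)
qed

lemma dist_segment_point:
  fixes y z :: "'a::real_normed_vector"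
  assumes "c \<in> {0..1}"
  shows "dist y ((1 - c) *\<^sub>R y + c *\<^sub>R z) = c * dist y z"
    and "dist ((1 - c) *\<^sub>R y + c *\<^sub>R z) z = (1 - c) * dist y z"
proof -
  have "y - ((1 - c) *\<^sub>R y + c *\<^sub>R z) = c *\<^sub>R (y - z)"
    "(1 - c) *\<^sub>R y + c *\<^sub>R z - z = (1 - c) *\<^sub>R (y - z)"
    by (simp_all add: algebra_simps)
  then show "dist y ((1 - c) *\<^sub>R y + c *\<^sub>R z) = c * dist y z"
    "dist ((1 - c) *\<^sub>R y + c *\<^sub>R z) z = (1 - c) * dist y z"
    using assms by (simp_all add: dist_norm)
qed

text \<open>The right-hand side involves \<open>y'\<close> and \<open>z'\<close> only through their
  distance. Hence the same \<open>c\<close> gives a comparison point in every comparison triangle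
  with that side length.\<close>

lemma comparison_point_segment:
  assumes "c \<in> {0..1}"
  shows "comparison_point \<sigma> t y' z' ((1 - c) *\<^sub>R y' + c *\<^sub>R z') \<longleftrightarrow>
    ereal (c * dist y' z') \<le> path_len (snd \<sigma>) 0 t \<and>
    ereal ((1 - c) * dist y' z') \<le> path_len (snd \<sigma>) t (fst \<sigma>)"
  unfolding comparison_point_def dist_segment_point[OF assms]
  using assms by (auto simp: closed_segment_def)

text \<open>By the intermediate value theorem the path has a point at distance exactly
  \<open>c * dist y z\<close> from \<open>y\<close>. The triangle inequality puts it at least
  \<open>(1 - c) * dist y z\<close> from \<open>z\<close>, and lengths dominate distances.\<close>

lemma comparison_point_exists:
  assumes \<tau>: "\<tau> \<in> short_segments X h y z" and d: "dist y' z' = dist y z" and c: "c \<in> {0..1}"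
  obtains s where "s \<in> {0..fst \<tau>}" "comparison_point \<tau> s y' z' ((1 - c) *\<^sub>R y' + c *\<^sub>R z')"
proof -
  note S = short_segmentsD[OF \<tau>]
  have cont: "continuous_on {0..fst \<tau>} (\<lambda>s. dist y (snd \<tau> s))"
    using S(2) by (intro continuous_intros)
  have "c * dist y z \<le> dist y z"
    using c by (simp add: mult_left_le_one_le)
  then obtain s where s: "0 \<le> s" "s \<le> fst \<tau>" "dist y (snd \<tau> s) = c * dist y z"
    using IVT'[of "\<lambda>s. dist y (snd \<tau> s)" 0 "c * dist y z" "fst \<tau>"] S(1,3,4) cont c by auto
  have "ereal (c * dist y z) \<le> path_len (snd \<tau>) 0 s"
    using dist_le_path_len[OF s(1), of "snd \<tau>"] S(3) s(3) by simp
  moreover have "(1 - c) * dist y z \<le> dist (snd \<tau> s) z"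
    using dist_triangle[of y z "snd \<tau> s"] s(3) by (simp add: algebra_simps)
  then have "ereal ((1 - c) * dist y z) \<le> path_len (snd \<tau>) s (fst \<tau>)"
    using dist_le_path_len[OF s(2), of "snd \<tau>"] S(4) by (meson ereal_less_eq(3) order_trans)
  ultimately show thesis
    using s by (intro that[of s]) (auto simp: comparison_point_segment[OF c] d)
qed

section \<open>The Euclidean estimate from Stewart's theorem\<close>

lemma stewart:
  fixes u y z :: "'a::real_inner"
  shows "(dist u ((1 - c) *\<^sub>R y + c *\<^sub>R z))\<^sup>2 =
    (1 - c) * (dist u y)\<^sup>2 + c * (dist u z)\<^sup>2 - c * (1 - c) * (dist y z)\<^sup>2"
  unfolding dist_norm power2_norm_eq_inner
  by (simp add: inner_commute algebra_simps)

text \<open>Here \<open>p\<close> and \<open>q\<close> are to be the lengths of the two subpaths cut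
  off by a point. In terms of their excesses \<open>s\<close> and \<open>t\<close> over the two
  parts of the Euclidean side, the terms in \<open>l\<^sup>2\<close> of Stewart's formula cancel,
  and what remains is controlled by \<open>s + t \<le> h\<close>.\<close>

lemma dist_point_over_segment_le:
  fixes u y z :: "'a::real_inner"
  assumes c: "c \<in> {0..1}" and "dist u y \<le> p" "dist u z \<le> q"
    and "c * dist y z \<le> p" "(1 - c) * dist y z \<le> q" and pq: "p + q \<le> dist y z + h"
    and h: "h \<le> 1" "h * dist y z \<le> 1"
  shows "dist u ((1 - c) *\<^sub>R y + c *\<^sub>R z) \<le> 1 + sqrt 3 / 2"
proof -
  define l s t where "l = dist y z" and "s = p - c * l" and "t = q - (1 - c) * l"
  have st: "0 \<le> s" "0 \<le> t" "s + t \<le> h" and l: "0 \<le> l"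
    using assms by (auto simp: s_def t_def l_def algebra_simps)
  have "(dist u ((1 - c) *\<^sub>R y + c *\<^sub>R z))\<^sup>2 \<le> (1 - c) * p\<^sup>2 + c * q\<^sup>2 - c * (1 - c) * l\<^sup>2"
    unfolding stewart l_def using assms
    by (intro diff_right_mono add_mono mult_left_mono power_mono) auto
  also have "\<dots> = 2 * (c * (1 - c)) * (l * (s + t)) + ((1 - c) * s\<^sup>2 + c * t\<^sup>2)"
    by (simp add: s_def t_def power2_eq_square algebra_simps)
  \<comment> \<open>The product \<open>c * (1 - c)\<close> is at most 1/4 and
    \<open>l * (s + t) \<le> l * h \<le> 1\<close>. The other term is a convex combination of two
    squares that are at most 1.\<close>
  also have "\<dots> \<le> 1 / 2 + 1"
  proof (rule add_mono)
    have "l * (s + t) \<le> l * h"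
      using st l by (intro mult_left_mono)
    then have "l * (s + t) \<le> 1"
      using h(2) by (simp add: l_def mult.commute)
    moreover have "0 \<le> l * (s + t)"
      using st l by simp
    moreover have "2 * (c * (1 - c)) \<le> 1 / 2"
      using zero_le_power2[of "c - 1 / 2"] by (simp add: power2_eq_square algebra_simps)
    ultimately show "2 * (c * (1 - c)) * (l * (s + t)) \<le> 1 / 2"
      using mult_mono[of "2 * (c * (1 - c))" "1 / 2" "l * (s + t)" 1] by simp
    have "s\<^sup>2 \<le> 1" "t\<^sup>2 \<le> 1"
      using st h by (auto simp: abs_square_le_1)
    then show "(1 - c) * s\<^sup>2 + c * t\<^sup>2 \<le> 1"
      using c convex_bound_le[of "s\<^sup>2" 1 "t\<^sup>2" "1 - c" c] by simp
  qed
  \<comment> \<open>The bound \<open>sqrt (3 / 2)\<close> is relaxed to the constant of the theorem,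
    which is at least 3/2 because \<open>sqrt 3 \<ge> 1\<close>.\<close>
  also have "\<dots> \<le> (3 / 2)\<^sup>2"
    by (simp add: power2_eq_square)
  also have "\<dots> \<le> (1 + sqrt 3 / 2)\<^sup>2"
    by (rule power_mono) simp_all
  finally show ?thesis
    by (rule power2_le_imp_le) simp
qed

section \<open>Replacing short segments by shorter ones\<close>

text \<open>
  The weak condition is the case \<open>\<Lambda> = {0..1}\<close>, the very weak one the case \<open>\<Lambda> = {1/2}\<close>.
\<close>

definition weak_rough_CAT0_on :: "real set \<Rightarrow> real \<Rightarrow> 'a::metric_space triangle_condition" where
  "weak_rough_CAT0_on \<Lambda> C x y z \<alpha> \<beta> \<gamma> \<longleftrightarrow>
     (\<forall>x' y' z'. comparison_triangle x y z x' y' z' \<longrightarrow>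
        (\<forall>t\<in>{0..fst \<beta>}. \<forall>c\<in>\<Lambda>. comparison_point \<beta> t y' z' ((1 - c) *\<^sub>R y' + c *\<^sub>R z') \<longrightarrow>
           dist (snd \<beta> t) x \<le> dist ((1 - c) *\<^sub>R y' + c *\<^sub>R z') x' + C))"

lemma weak_rough_CAT0_eq:
  "(weak_rough_CAT0 C :: 'a::metric_space triangle_condition) = weak_rough_CAT0_on {0..1} C"
proof (intro ext)
  fix x y z :: 'a and \<alpha> \<beta> \<gamma> :: "'a mpath"
  have "comparison_point \<beta> t y' z' u' \<Longrightarrow> \<exists>c\<in>{0..1}. u' = (1 - c) *\<^sub>R y' + c *\<^sub>R z'" for t y' z' u'
    by (auto simp: comparison_point_def closed_segment_def)
  then show "weak_rough_CAT0 C x y z \<alpha> \<beta> \<gamma> = weak_rough_CAT0_on {0..1} C x y z \<alpha> \<beta> \<gamma>"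
    unfolding weak_rough_CAT0_def weak_rough_CAT0_on_def by blast
qed

lemma very_weak_rough_CAT0_eq: "very_weak_rough_CAT0 C = weak_rough_CAT0_on {1 / 2} C"
proof -
  have "midpoint y z = (1 - 1 / 2) *\<^sub>R y + (1 / 2) *\<^sub>R z" for y z :: "real^2"
    by (simp add: midpoint_def scaleR_add_right)
  note mid = this
  show ?thesis
    by (intro ext)
      (simp only: very_weak_rough_CAT0_def weak_rough_CAT0_on_def ball_simps simp_thms mid)
qed

text \<open>The vertex \<open>x\<close> is the endpoint of the side \<gamma>, and \<open>x'\<close>
  is a comparison point for it there: the subpath after it is trivial. So the weak condition is an
  instance of the condition for the sides \<beta> and \<gamma>.\<close>

lemma rough_CAT0_imp_weak:
  assumes "rough_CAT0 C x y z \<alpha> \<beta> \<gamma>" "\<gamma> \<in> short_segments X h z x"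
  shows "weak_rough_CAT0 C x y z \<alpha> \<beta> \<gamma>"
  unfolding weak_rough_CAT0_def
proof (intro allI impI ballI)
  fix x' y' z' t u'
  assume ct: "comparison_triangle x y z x' y' z'" and t: "t \<in> {0..fst \<beta>}"
    and cp: "comparison_point \<beta> t y' z' u'"
  note S = short_segmentsD[OF assms(2)]
  have "comparison_point \<gamma> (fst \<gamma>) z' x' x'"
    using dist_le_path_len[OF S(1), of "snd \<gamma>"] path_len_nonneg[of "fst \<gamma>" "fst \<gamma>" "snd \<gamma>"] S ct
    by (simp add: comparison_point_def comparison_triangle_def zero_ereal_def)
  moreover have "sides_rough_CAT0 C \<beta> y' z' \<gamma> z' x'"
    using assms(1) ct by (simp add: rough_CAT0_def)
  ultimately show "dist (snd \<beta> t) x \<le> dist u' x' + C"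
    using t cp S(1,4) unfolding sides_rough_CAT0_def by (metis atLeastAtMost_iff order_refl)
qed

text \<open>The parameter \<open>c\<close> is kept throughout, so the argument works for any
  \<Lambda>, in particular for midpoints alone. The tolerance \<open>k\<close> is left free for the
  triangle to which \<tau> is to belong later.\<close>

lemma shorter_segment_near:
  assumes X: "length_space X" and H: "\<And>x y z. x \<in> X \<Longrightarrow> y \<in> X \<Longrightarrow> z \<in> X \<Longrightarrow> 0 < H x y z"
    and sat: "triangles_satisfy (weak_rough_CAT0_on \<Lambda> C) X H" and \<Lambda>: "\<Lambda> \<subseteq> {0..1}"
    and yz: "y \<in> X" "z \<in> X" and \<sigma>: "\<sigma> \<in> short_segments X h y z" and h: "h \<le> 1" "h * dist y z \<le> 1"
    and t: "t \<in> {0..fst \<sigma>}" and d: "dist y' z' = dist y z" and c: "c \<in> \<Lambda>"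
    and cp: "comparison_point \<sigma> t y' z' ((1 - c) *\<^sub>R y' + c *\<^sub>R z')" and k: "0 < k"
  obtains \<tau> s where "\<tau> \<in> short_segments X k y z" "s \<in> {0..fst \<tau>}"
    "comparison_point \<tau> s y' z' ((1 - c) *\<^sub>R y' + c *\<^sub>R z')"
    "dist (snd \<sigma> t) (snd \<tau> s) \<le> C + (1 + sqrt 3 / 2)"
proof -
  define u where "u = snd \<sigma> t"
  \<comment> \<open>Short enough both for the caller and for the triangle with apex
    \<open>u\<close>. As \<open>H\<close> may depend on \<open>u\<close>, the segment \<tau> is
    chosen only after the point.\<close>
  define e where "e = min k (H u y z)"
  note S = short_segmentsD[OF \<sigma>]
  have u: "u \<in> X" using S(5) t by (simp add: u_def)
  have l01: "c \<in> {0..1}" using c \<Lambda> by auto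
  have Hu: "0 < H u y z" and e: "0 < e" using H u yz k by (auto simp: e_def)
  obtain \<tau> where \<tau>: "\<tau> \<in> short_segments X e y z"
    using short_segments_nonempty[OF X yz e] .
  have \<tau>k: "\<tau> \<in> short_segments X k y z" and \<tau>H: "\<tau> \<in> short_segments X (H u y z) y z"
    using \<tau> short_segments_mono[of e k X y z] short_segments_mono[of e "H u y z" X y z]
    by (auto simp: e_def)
  obtain s where s: "s \<in> {0..fst \<tau>}"
    and cps: "comparison_point \<tau> s y' z' ((1 - c) *\<^sub>R y' + c *\<^sub>R z')"
    using comparison_point_exists[OF \<tau> d l01] .
  \<comment> \<open>Arbitrary sides at \<open>u\<close> that complete \<tau> to a triangle covered
    by the hypothesis.\<close>
  obtain \<alpha> \<gamma> where \<alpha>: "\<alpha> \<in> short_segments X (H u y z) u y"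
    and \<gamma>: "\<gamma> \<in> short_segments X (H u y z) z u"
    using short_segments_nonempty[OF X] u yz Hu by metis
  have W: "weak_rough_CAT0_on \<Lambda> C u y z \<alpha> \<tau> \<gamma>"
    using sat u yz \<alpha> \<tau>H \<gamma> unfolding triangles_satisfy_def by blast
  obtain u'' y'' z'' where ct: "comparison_triangle u y z u'' y'' z''"
    using comparison_triangle_exists .
  then have ds: "dist u'' y'' = dist y u" "dist u'' z'' = dist u z" "dist y'' z'' = dist y z"
    by (auto simp: comparison_triangle_def dist_commute)
  \<comment> \<open>The comparison point moves to the triangle with apex \<open>u''\<close> because
    the sides opposite to the apexes have equal length.\<close>
  have "comparison_point \<tau> s y'' z'' ((1 - c) *\<^sub>R y'' + c *\<^sub>R z'')"
    using cps ds d by (simp add: comparison_point_segment[OF l01])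
  then have 1: "dist (snd \<tau> s) u \<le> dist ((1 - c) *\<^sub>R y'' + c *\<^sub>R z'') u'' + C"
    using W ct s c unfolding weak_rough_CAT0_on_def by blast
  obtain p q where pq: "path_len (snd \<sigma>) 0 t = ereal p" "path_len (snd \<sigma>) t (fst \<sigma>) = ereal q"
    "p + q \<le> dist y z + h"
    using path_len_split[of 0 t "fst \<sigma>" "snd \<sigma>"] t S(6) by auto
  \<comment> \<open>The subpath lengths \<open>p\<close> and \<open>q\<close> of \<sigma> bound the
    distances from \<open>u\<close> to \<open>y\<close> and \<open>z\<close>, and also the two parts
    of the Euclidean side, since \<open>c\<close> gives a comparison point for \<open>u\<close> on
    \<sigma>.\<close>
  have "dist u'' ((1 - c) *\<^sub>R y'' + c *\<^sub>R z'') \<le> 1 + sqrt 3 / 2"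
  proof (rule dist_point_over_segment_le[OF l01, where p = p and q = q and h = h])
    show "dist u'' y'' \<le> p" "dist u'' z'' \<le> q"
      using dist_le_path_len[of 0 t "snd \<sigma>"] dist_le_path_len[of t "fst \<sigma>" "snd \<sigma>"] t pq S(3,4)
      by (simp_all add: ds u_def)
    show "c * dist y'' z'' \<le> p" "(1 - c) * dist y'' z'' \<le> q"
      using cp pq by (simp_all add: comparison_point_segment[OF l01] ds d)
  qed (use pq h ds in simp_all)
  with 1 have "dist (snd \<sigma> t) (snd \<tau> s) \<le> C + (1 + sqrt 3 / 2)"
    by (simp add: u_def dist_commute)
  then show thesis using that \<tau>k s cps by blast
qed

section \<open>Passage to the standard choice of h\<close>

lemma standard_H_bounds:
  "standard_H x y z \<le> 1" "standard_H x y z * dist x y \<le> 1"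
  "standard_H x y z * dist y z \<le> 1" "standard_H x y z * dist z x \<le> 1"
proof -
  define M where "M = Max {1, dist x y, dist x z, dist y z}"
  have "1 \<le> M" "dist x y \<le> M" "dist y z \<le> M" "dist z x \<le> M"
    by (auto simp: M_def dist_commute)
  then show "standard_H x y z \<le> 1" "standard_H x y z * dist x y \<le> 1"
    "standard_H x y z * dist y z \<le> 1" "standard_H x y z * dist z x \<le> 1"
    unfolding standard_H_def M_def[symmetric] by (simp_all add: field_simps)
qed

text \<open>One replacement costs \<open>C + (1 + sqrt 3 / 2)\<close>, and the hypothesis for the
  triangle with the new side costs another \<open>C\<close>.\<close>

theorem weak_star_imp_weak_on:
  assumes "rCAT0_star_for (weak_rough_CAT0_on \<Lambda> C) X" and \<Lambda>: "\<Lambda> \<subseteq> {0..1}"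
  shows "rCAT0_for (weak_rough_CAT0_on \<Lambda> (2 * C + 1 + sqrt 3 / 2)) X"
proof -
  obtain H where X: "length_space X"
    and H: "\<And>x y z. x \<in> X \<Longrightarrow> y \<in> X \<Longrightarrow> z \<in> X \<Longrightarrow> 0 < H x y z"
    and sat: "triangles_satisfy (weak_rough_CAT0_on \<Lambda> C) X H"
    using assms(1) unfolding rCAT0_star_for_def by blast
  have "weak_rough_CAT0_on \<Lambda> (2 * C + 1 + sqrt 3 / 2) x y z \<alpha> \<beta> \<gamma>"
    if x: "x \<in> X" and yz: "y \<in> X" "z \<in> X" and \<beta>: "\<beta> \<in> short_segments X (standard_H x y z) y z"
    for x y z \<alpha> \<beta> \<gamma>
    unfolding weak_rough_CAT0_on_def
  proof (intro allI impI ballI)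
    fix x' y' z' t c
    assume ct: "comparison_triangle x y z x' y' z'" and t: "t \<in> {0..fst \<beta>}" and c: "c \<in> \<Lambda>"
      and cp: "comparison_point \<beta> t y' z' ((1 - c) *\<^sub>R y' + c *\<^sub>R z')"
    have Hx: "0 < H x y z" using H x yz by blast
    have d: "dist y' z' = dist y z" using ct by (simp add: comparison_triangle_def)
    obtain \<tau> s where \<tau>: "\<tau> \<in> short_segments X (H x y z) y z" and s: "s \<in> {0..fst \<tau>}"
      and cps: "comparison_point \<tau> s y' z' ((1 - c) *\<^sub>R y' + c *\<^sub>R z')"
      and near: "dist (snd \<beta> t) (snd \<tau> s) \<le> C + (1 + sqrt 3 / 2)"
      using shorter_segment_near[OF X H sat \<Lambda> yz \<beta> standard_H_bounds(1,3) t d c cp Hx] .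
    \<comment> \<open>The given sides at \<open>x\<close> need not be short enough for
      \<open>H\<close>; the conclusion concerns only the opposite side, so others may take their
      place.\<close>
    obtain \<alpha>' \<gamma>' where "\<alpha>' \<in> short_segments X (H x y z) x y" "\<gamma>' \<in> short_segments X (H x y z) z x"
      using short_segments_nonempty[OF X] x yz Hx by metis
    then have "weak_rough_CAT0_on \<Lambda> C x y z \<alpha>' \<tau> \<gamma>'"
      using sat x yz \<tau> unfolding triangles_satisfy_def by blast
    then have "dist (snd \<tau> s) x \<le> dist ((1 - c) *\<^sub>R y' + c *\<^sub>R z') x' + C"
      using ct s c cps unfolding weak_rough_CAT0_on_def by blast
    with near dist_triangle[of "snd \<beta> t" x "snd \<tau> s"]
    show "dist (snd \<beta> t) x \<le> dist ((1 - c) *\<^sub>R y' + c *\<^sub>R z') x' + (2 * C + 1 + sqrt 3 / 2)"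
      by linarith
  qed
  with X show ?thesis unfolding rCAT0_for_def triangles_satisfy_def by blast
qed

text \<open>Stated for an abstract pair of sides so as to serve all three pairs of a triangle. A
  point on each side is replaced, and \<open>sides\<close> compares the two new points:
  \<open>2 * (C + 1 + sqrt 3 / 2) + C = 3 * C + 2 + sqrt 3\<close>.\<close>

lemma sides_rough_CAT0_shorter:
  assumes X: "length_space X" and H: "\<And>x y z. x \<in> X \<Longrightarrow> y \<in> X \<Longrightarrow> z \<in> X \<Longrightarrow> 0 < H x y z"
    and sat: "triangles_satisfy (weak_rough_CAT0 C) X H"
    and V: "p \<in> X" "q \<in> X" "r \<in> X" "s \<in> X"
    and \<sigma>: "\<sigma> \<in> short_segments X h p q" and \<tau>: "\<tau> \<in> short_segments X h r s"
    and h: "h \<le> 1" "h * dist p q \<le> 1" "h * dist r s \<le> 1"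
    and d: "dist p' q' = dist p q" "dist r' s' = dist r s" and k: "0 < k"
    and sides: "\<And>\<sigma>' \<tau>'. \<sigma>' \<in> short_segments X k p q \<Longrightarrow> \<tau>' \<in> short_segments X k r s \<Longrightarrow>
      sides_rough_CAT0 C \<sigma>' p' q' \<tau>' r' s'"
  shows "sides_rough_CAT0 (3 * C + 2 + sqrt 3) \<sigma> p' q' \<tau> r' s'"
  unfolding sides_rough_CAT0_def
proof (intro ballI allI impI)
  fix t t' u' v'
  assume t: "t \<in> {0..fst \<sigma>}" and t': "t' \<in> {0..fst \<tau>}"
    and u': "comparison_point \<sigma> t p' q' u'" and v': "comparison_point \<tau> t' r' s' v'"
  note sat' = sat[unfolded weak_rough_CAT0_eq]
  obtain c c' where c: "c \<in> {0..1}" "u' = (1 - c) *\<^sub>R p' + c *\<^sub>R q'"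
    and c': "c' \<in> {0..1}" "v' = (1 - c') *\<^sub>R r' + c' *\<^sub>R s'"
    using u' v' by (auto simp: comparison_point_def closed_segment_def)
  obtain \<sigma>' a where \<sigma>': "\<sigma>' \<in> short_segments X k p q" "a \<in> {0..fst \<sigma>'}"
      "comparison_point \<sigma>' a p' q' u'" "dist (snd \<sigma> t) (snd \<sigma>' a) \<le> C + (1 + sqrt 3 / 2)"
    using shorter_segment_near[OF X H sat' order_refl V(1,2) \<sigma> h(1,2) t d(1) c(1) u'[unfolded c(2)] k]
    unfolding c(2) .
  obtain \<tau>' b where \<tau>': "\<tau>' \<in> short_segments X k r s" "b \<in> {0..fst \<tau>'}"
      "comparison_point \<tau>' b r' s' v'" "dist (snd \<tau> t') (snd \<tau>' b) \<le> C + (1 + sqrt 3 / 2)"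
    using shorter_segment_near[OF X H sat' order_refl V(3,4) \<tau> h(1,3) t' d(2) c'(1) v'[unfolded c'(2)] k]
    unfolding c'(2) .
  have "dist (snd \<sigma>' a) (snd \<tau>' b) \<le> dist u' v' + C"
    using sides[OF \<sigma>'(1) \<tau>'(1)] \<sigma>' \<tau>' unfolding sides_rough_CAT0_def by blast
  moreover have "dist (snd \<sigma> t) (snd \<tau> t') \<le>
      dist (snd \<sigma> t) (snd \<sigma>' a) + dist (snd \<sigma>' a) (snd \<tau>' b) + dist (snd \<tau> t') (snd \<tau>' b)"
    using dist_triangle[of "snd \<sigma> t" "snd \<tau> t'" "snd \<sigma>' a"]
      dist_triangle[of "snd \<sigma>' a" "snd \<tau> t'" "snd \<tau>' b"] by (simp add: dist_commute)
  ultimately show "dist (snd \<sigma> t) (snd \<tau> t') \<le> dist u' v' + (3 * C + 2 + sqrt 3)"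
    using \<sigma>'(4) \<tau>'(4) by simp
qed

text \<open>The weak condition follows with the same \<open>H\<close>, which makes the replacement
  of points on each side available.\<close>

theorem rough_star_imp_rough:
  assumes "rCAT0_star C X"
  shows "rCAT0 (3 * C + 2 + sqrt 3) X"
proof -
  obtain H where X: "length_space X"
    and H: "\<And>x y z. x \<in> X \<Longrightarrow> y \<in> X \<Longrightarrow> z \<in> X \<Longrightarrow> 0 < H x y z"
    and sat: "triangles_satisfy (rough_CAT0 C) X H"
    using assms unfolding rCAT0_star_def rCAT0_star_for_def by blast
  have weak: "triangles_satisfy (weak_rough_CAT0 C) X H"
    using sat rough_CAT0_imp_weak unfolding triangles_satisfy_def by blast
  have "rough_CAT0 (3 * C + 2 + sqrt 3) x y z \<alpha> \<beta> \<gamma>"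
    if V: "x \<in> X" "y \<in> X" "z \<in> X" and \<alpha>: "\<alpha> \<in> short_segments X (standard_H x y z) x y"
      and \<beta>: "\<beta> \<in> short_segments X (standard_H x y z) y z"
      and \<gamma>: "\<gamma> \<in> short_segments X (standard_H x y z) z x"
    for x y z \<alpha> \<beta> \<gamma>
    unfolding rough_CAT0_def
  proof (intro allI impI)
    fix x' y' z'
    assume ct: "comparison_triangle x y z x' y' z'"
    then have d: "dist x' y' = dist x y" "dist y' z' = dist y z" "dist z' x' = dist z x"
      by (auto simp: comparison_triangle_def)
    have k: "0 < H x y z" using H V by blast
    have R: "rough_CAT0 C x y z \<alpha>' \<beta>' \<gamma>'" if "\<alpha>' \<in> short_segments X (H x y z) x y"
      "\<beta>' \<in> short_segments X (H x y z) y z" "\<gamma>' \<in> short_segments X (H x y z) z x" for \<alpha>' \<beta>' \<gamma>'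
      using sat V that unfolding triangles_satisfy_def by blast
    \<comment> \<open>When two sides have been replaced, one of these serves as the third side of a
      triangle to which \<open>R\<close> applies.\<close>
    obtain \<alpha>\<^sub>0 \<beta>\<^sub>0 \<gamma>\<^sub>0 where S: "\<alpha>\<^sub>0 \<in> short_segments X (H x y z) x y"
      "\<beta>\<^sub>0 \<in> short_segments X (H x y z) y z" "\<gamma>\<^sub>0 \<in> short_segments X (H x y z) z x"
      using short_segments_nonempty[OF X] V k by metis
    note B = standard_H_bounds[of x y z]
    show "sides_rough_CAT0 (3 * C + 2 + sqrt 3) \<alpha> x' y' \<beta> y' z' \<and>
        sides_rough_CAT0 (3 * C + 2 + sqrt 3) \<beta> y' z' \<gamma> z' x' \<and>
        sides_rough_CAT0 (3 * C + 2 + sqrt 3) \<gamma> z' x' \<alpha> x' y'"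
    proof (intro conjI)
      show "sides_rough_CAT0 (3 * C + 2 + sqrt 3) \<alpha> x' y' \<beta> y' z'"
        by (rule sides_rough_CAT0_shorter[OF X H weak V(1,2,2,3) \<alpha> \<beta> B(1,2,3) d(1,2) k])
          (use R[OF _ _ S(3)] ct in \<open>auto simp: rough_CAT0_def\<close>)
      show "sides_rough_CAT0 (3 * C + 2 + sqrt 3) \<beta> y' z' \<gamma> z' x'"
        by (rule sides_rough_CAT0_shorter[OF X H weak V(2,3,3,1) \<beta> \<gamma> B(1,3,4) d(2,3) k])
          (use R[OF S(1)] ct in \<open>auto simp: rough_CAT0_def\<close>)
      show "sides_rough_CAT0 (3 * C + 2 + sqrt 3) \<gamma> z' x' \<alpha> x' y'"
        by (rule sides_rough_CAT0_shorter[OF X H weak V(3,1,1,2) \<gamma> \<alpha> B(1,4,2) d(3,1) k])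
          (use R[OF _ S(2)] ct in \<open>auto simp: rough_CAT0_def\<close>)
    qed
  qed
  with X show ?thesis unfolding rCAT0_def rCAT0_for_def triangles_satisfy_def by blast
qed

theorem corollary4p4:
  fixes X :: "'a::metric_space set" and C :: real
  assumes "C > 0"
  shows "(rCAT0_star C X \<longrightarrow> rCAT0 (3 * C + 2 + sqrt 3) X)
       \<and> (weak_rCAT0_star C X \<longrightarrow> weak_rCAT0 (2 * C + 1 + sqrt 3 / 2) X)
       \<and> (very_weak_rCAT0_star C X \<longrightarrow> very_weak_rCAT0 (2 * C + 1 + sqrt 3 / 2) X)"
  \<comment> \<open>Both weak variants become instances of one theorem, with \<Lambda> equal to
    \<open>{0..1}\<close> and \<open>{1 / 2}\<close>.\<close>
  unfolding weak_rCAT0_star_def weak_rCAT0_def very_weak_rCAT0_star_def very_weak_rCAT0_def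
    weak_rough_CAT0_eq very_weak_rough_CAT0_eq
  by (intro conjI impI rough_star_imp_rough weak_star_imp_weak_on) auto

end
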